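(* Assume the setting and hypotheses (A.1)–(A.7) described in the context, and suppose moreover that $g(\nu)=\alpha\nu+1$ for all $\nu\in\mathbb{N}_0$, for some constant $\alpha$. Let $M(x)=\max_{n\le x}\log f(f(n))$. Then, for sufficiently large $x$, \[ M(x)\ge \frac{\sqrt{\log x}}{\log_2 x}\left(\frac{C_g}{\sqrt{\kappa/\alpha}}+\mathcal{O}\!\left(\frac{\log_3 x}{\log_2 x}\right)\right), \qquad C_g=\left(8\sum_{j=1}^{\infty}\left(\log\frac{g(j)}{g(j-1)}\right)^2\right)^{1/2}. \]
   Context: Setting: let $(q_j)_{j\ge1}$ be a strictly increasing sequence of primes, $Q=\{q_j:j\in\mathbb{N}\}$, and $\langle Q\rangle$ the multiplicative monoid generated by $Q$ (products of elements of $Q$, including $1$). Let $g:\mathbb{N}_0\to\mathbb{N}$ with $g(0)=1$, and $g^{\dagger}(y)=\inf\{x\in\mathbb{N}: g(x)=y\}\in\mathbb{N}\cup\{+\infty\}$. Hypotheses: (A.1) $q_j=\kappa j(\log j+\log\log j+\mathcal{O}(1))$ for some constant $\kappa>0$; (A.2) $g$ is monotonically increasing; (A.3) $g(\mathbb{N})\supseteq\langle Q\rangle$; (A.4) $g^{\dagger}(b)+c_* b\, g^{\dagger}(a)\le g^{\dagger}(ab)$ for all $a,b\in\langle Q\rangle$ with $q_1\le a\le b$, where $c_*>1/q_1$ is a constant; (A.5) $g(i)/g(i-1)=1+\mathcal{O}(i^{-1/2-\epsilon})$ for some $\epsilon>0$; (A.6) $g(x)\le c_f x$ for all $x\in\mathbb{N}$,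 for some constant $c_f>0$; (A.7) $g^{\dagger}(q)=c_\dagger q+\mathcal{O}(q/\log q)$ as $Q\ni q\to\infty$, for some constant $c_\dagger>0$. Let $f$ be a multiplicative arithmetic function with, for every prime power $p^\nu$ with $\nu\ge1$, $f(p^\nu)=g(\nu)$ if $p\in Q$ and $f(p^\nu)\in\{0,1\}$ if $p\notin Q$; also $f(0)=1$. $\log$ is the natural logarithm, $\log_k$ the $k$-fold iterated logarithm, $\log 0=-\infty$, and the maximum is over positive integers $n\le x$. Implied constants may depend on $f$ and $Q$.
   Formalization: Hypothesis (A.3) is taken as g(N_0) ⊇ ⟨Q⟩ instead of g(N) ⊇ ⟨Q⟩: since 1 ∈ ⟨Q⟩ and g(ν)=αν+1, requiring 1 to be attained at a positive argument would force α=0 and contradict the other elements of ⟨Q⟩. *)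

theory Defs
  imports "HOL-Analysis.Analysis" "HOL-Library.Landau_Symbols"
    "HOL-Library.Extended_Nat" "HOL-Computational_Algebra.Primes"
begin

definition mult_monoid :: "nat set \<Rightarrow> nat set" where
  "mult_monoid Q = {prod_mset A | A. set_mset A \<subseteq> Q}"

(* In enat, the infimum of the empty set is \<infinity>. *)
definition gdagger :: "(nat \<Rightarrow> nat) \<Rightarrow> nat \<Rightarrow> enat" where
  "gdagger g y = Inf (enat ` {x. x \<ge> 1 \<and> g x = y})"

definition multiplicative :: "(nat \<Rightarrow> nat) \<Rightarrow> bool" where
  "multiplicative f \<longleftrightarrow> f 1 = 1 \<and>
     (\<forall>m n. m > 0 \<longrightarrow> n > 0 \<longrightarrow> coprime m n \<longrightarrow> f (m * n) = f m * f n)"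

(* Natural logarithm with log 0 = -\<infinity> (the library has ln 0 = 0). *)
definition elog :: "nat \<Rightarrow> ereal" where
  "elog m = (if m = 0 then -\<infinity> else ereal (ln (real m)))"

(* Meaningful for x \<ge> 1, where the set is finite and nonempty. *)
definition max_log_ff :: "(nat \<Rightarrow> nat) \<Rightarrow> real \<Rightarrow> ereal" where
  "max_log_ff f x = Max ((\<lambda>n. elog (f (f n))) ` {n. n \<ge> 1 \<and> real n \<le> x})"

(* The sum over j \<ge> 1 is reindexed to start at 0. *)
definition C_const :: "(nat \<Rightarrow> nat) \<Rightarrow> real" where
  "C_const g = sqrt (8 * (\<Sum>j. (ln (real (g (Suc j)) / real (g j)))\<^sup>2))"

end

theory Submission
  imports Defs "HOL-Real_Asymp.Real_Asymp"
begin

text \<open>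
  Put \<open>d\<^sub>i = log (g (i+1) / g i)\<close> and let \<open>J\<^sub>i\<close> be about \<open>\<lambda> d\<^sub>i\<close>, the proportion suggested by Lagrange
  multipliers. Let \<open>m\<close> be the product of \<open>q\<^sub>1 \<dots> q\<^bsub>J\<^sub>i\<^esub>\<close> over the first few \<open>i\<close>. Then
  \<open>log (f m) = \<Sum> d\<^sub>i J\<^sub>i\<close>, which is about \<open>\<lambda> \<Sum> d\<^sub>i\<^sup>2\<close>. Each prime factor \<open>r\<close> of \<open>m\<close>, counted with
  multiplicity, is \<open>f (p ^ ((r - 1) / \<alpha>))\<close> for any \<open>p\<close> in \<open>Q\<close>; spending distinct primes \<open>p\<close>, as small as
  possible, gives \<open>n\<close> with \<open>f n = m\<close> and \<open>log n\<close> about \<open>\<kappa> / (2 \<alpha>) (\<lambda> log \<lambda>)\<^sup>2 \<Sum> d\<^sub>i\<^sup>2\<close>. Taking \<open>\<lambda>\<close> as large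
  as \<open>log n \<le> log x\<close> permits yields the bound.
\<close>

section \<open>Multiplicative functions on coprime products, and initial segments of the
  naturals\<close>

lemma multiplicative_prod:
  assumes "multiplicative f" "finite S" "\<And>i. i \<in> S \<Longrightarrow> F i > 0"
    "\<And>i j. i \<in> S \<Longrightarrow> j \<in> S \<Longrightarrow> i \<noteq> j \<Longrightarrow> coprime (F i) (F j)"
  shows "f (\<Prod>i\<in>S. F i) = (\<Prod>i\<in>S. f (F i))"
  using assms(2-)
proof (induction S rule: finite_induct)
  case empty
  then show ?case using assms(1) by (simp add: multiplicative_def)
next
  case (insert i S)
  have "coprime (F i) (\<Prod>j\<in>S. F j)"
    by (rule prod_coprime_right) (use insert in auto)
  moreover have "F i > 0" "(\<Prod>j\<in>S. F j) > 0"
    using insert.prems by (auto intro!: prod_pos)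
  ultimately have "f (F i * (\<Prod>j\<in>S. F j)) = f (F i) * f (\<Prod>j\<in>S. F j)"
    using assms(1) by (auto simp: multiplicative_def)
  then show ?case using insert by simp
qed

text \<open>Needed to identify the set of rows that reach a given column of a staircase, so that a
  sum over it telescopes.\<close>

lemma finite_downward_closed_nat:
  fixes S :: "nat set"
  assumes "finite S" "\<And>i j. j \<in> S \<Longrightarrow> i \<le> j \<Longrightarrow> i \<in> S"
  shows "S = {..<card S}"
proof (cases "S = {}")
  case False
  have "S = {..Max S}"
    using Max_in[OF assms(1) False] by (auto intro: Max_ge assms)
  then show ?thesis by (metis card_atMost lessThan_Suc_atMost)
qed simp

section \<open>Logarithmic increments of \<open>a * i + 1\<close> and the series of their
  squares\<close>

text \<open>This is \<open>ln (g (i + 1) / g i)\<close> for \<open>g i = a * i + 1\<close>, in a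
  form where positivity, monotonicity in \<open>i\<close> and decay can be read off.\<close>

definition step_log :: "nat \<Rightarrow> nat \<Rightarrow> real" where
  "step_log a i = ln (1 + real a / (real a * real i + 1))"

lemma step_log_nonneg: "step_log a i \<ge> 0"
  by (auto simp: step_log_def)

lemma step_log_pos: "a > 0 \<Longrightarrow> step_log a i > 0"
  unfolding step_log_def by (rule ln_gt_zero) (auto intro!: divide_pos_pos add_nonneg_pos)

lemma step_log_antimono: "i \<le> j \<Longrightarrow> step_log a j \<le> step_log a i"
  unfolding step_log_def
  by (intro ln_mono add_left_mono divide_left_mono add_pos_nonneg)
     (auto intro!: mult_left_mono mult_pos_pos add_nonneg_pos)

lemma step_log_eq:
  "step_log a i = ln (real (a * Suc i + 1)) - ln (real (a * i + 1))"
proof -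
  have "1 + real a / (real a * real i + 1) = real (a * Suc i + 1) / real (a * i + 1)"
    by (simp add: field_simps add_nonneg_eq_0_iff)
  moreover have "ln (real (a * Suc i + 1) / real (a * i + 1)) = ln (real (a * Suc i + 1)) - ln (real (a * i + 1))"
    by (rule ln_divide_pos) (simp_all del: of_nat_add of_nat_Suc of_nat_mult)
  ultimately show ?thesis by (simp add: step_log_def)
qed

lemma sum_step_log: "(\<Sum>i<n. step_log a i) = ln (real (a * n + 1))"
  unfolding step_log_eq using sum_lessThan_telescope[of "\<lambda>i. ln (real (a * i + 1))" n] by simp

lemma step_log_le: "i \<ge> 1 \<Longrightarrow> step_log a i \<le> 1 / real i"
proof -
  assume i: "i \<ge> 1"
  have "step_log a i \<le> real a / (real a * real i + 1)"
    unfolding step_log_def by (rule ln_add_one_self_le_self) auto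
  also have "\<dots> \<le> 1 / real i"
    using i by (simp add: field_simps add_pos_nonneg)
  finally show ?thesis .
qed

text \<open>Comparing \<open>1 / i^2\<close> with \<open>1 / (i * (i - 1))\<close> gives a
  telescoping majorant, hence both summability and an explicit tail.\<close>

lemma step_log_square_le:
  assumes "i \<ge> 2"
  shows "(step_log a i)\<^sup>2 \<le> 1 / (real i - 1) - 1 / real i"
proof -
  have "(step_log a i)\<^sup>2 \<le> (1 / real i)\<^sup>2"
    using assms by (intro power_mono step_log_le step_log_nonneg) auto
  also have "\<dots> \<le> 1 / (real i * (real i - 1))"
    using assms by (simp add: power2_eq_square divide_simps)
  also have "\<dots> = 1 / (real i - 1) - 1 / real i"
    using assms by (simp add: field_simps)
  finally show ?thesis .
qed

lemma inverse_telescope_sums: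
  assumes "n \<ge> 2"
  shows "(\<lambda>i. 1 / (real (i + n) - 1) - 1 / real (i + n)) sums (1 / (real n - 1))"
proof -
  have "(\<lambda>i. 1 / (real (i + n) - 1)) \<longlonglongrightarrow> 0"
    by real_asymp
  from telescope_sums'[OF this]
  have "(\<lambda>i. 1 / (real (i + n) - 1) - 1 / (real (Suc i + n) - 1)) sums (1 / (real n - 1))"
    by simp
  then show ?thesis by simp
qed

lemma summable_step_log_square: "summable (\<lambda>i. (step_log a i)\<^sup>2)"
proof -
  have "summable (\<lambda>i. (step_log a (i + 2))\<^sup>2)"
    by (rule summable_comparison_test'[OF sums_summable[OF inverse_telescope_sums[of 2]], of 0])
       (use step_log_square_le in \<open>auto simp del: of_nat_add of_nat_Suc\<close>)
  then show ?thesis by (rule summable_iff_shift[THEN iffD1])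
qed

text \<open>Measures what is lost when only the first \<open>n\<close> rows are used.\<close>

lemma step_log_square_tail:
  assumes "n \<ge> 2"
  shows "(\<Sum>i. (step_log a i)\<^sup>2) \<le> (\<Sum>i<n. (step_log a i)\<^sup>2) + 1 / (real n - 1)"
proof -
  have "(\<Sum>i. (step_log a (i + n))\<^sup>2) \<le> 1 / (real n - 1)"
  proof (rule sums_le[OF _ summable_sums inverse_telescope_sums[OF assms]])
    show "summable (\<lambda>i. (step_log a (i + n))\<^sup>2)"
      using summable_step_log_square by (rule summable_ignore_initial_segment)
  qed (use assms step_log_square_le in \<open>auto simp del: of_nat_add\<close>)
  then show ?thesis
    using suminf_split_initial_segment[OF summable_step_log_square, of a n] by linarith
qed

section \<open>Construction of \<open>N\<close> with \<open>f (f N)\<close> large and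
  \<open>ln N\<close> controlled\<close>

text \<open>By \<open>q_cong\<close> each prime \<open>q j\<close> is itself a value of
  \<open>f\<close> at a power of any prime of the sequence, so it can be prescribed as a factor of
  \<open>f N\<close>.\<close>

locale linear_exponents =
  fixes q :: "nat \<Rightarrow> nat" and f :: "nat \<Rightarrow> nat" and a :: nat
  assumes prime_q: "j \<ge> 1 \<Longrightarrow> prime (q j)"
    and strict_q: "strict_mono_on {1..} q"
    and a_pos: "a > 0"
    and f_mult: "multiplicative f"
    and f_prime_power: "j \<ge> 1 \<Longrightarrow> f (q j ^ \<nu>) = a * \<nu> + 1"
    and q_cong: "j \<ge> 1 \<Longrightarrow> \<exists>r. q j = a * r + 1"
begin

lemma q_less: "1 \<le> i \<Longrightarrow> i < j \<Longrightarrow> q i < q j"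
  using strict_q by (auto simp: strict_mono_on_def)

text \<open>Serves both applications of \<open>f\<close>: with \<open>h\<close> the identity for the
  staircase product, and with \<open>h\<close> an enumeration of its factors for
  \<open>N\<close>.\<close>

lemma f_prod_prime_powers:
  assumes "finite S" "inj_on h S" "\<And>s. s \<in> S \<Longrightarrow> h s \<ge> 1"
  shows "f (\<Prod>s\<in>S. q (h s) ^ e s) = (\<Prod>s\<in>S. a * e s + 1)"
proof -
  have "f (\<Prod>s\<in>S. q (h s) ^ e s) = (\<Prod>s\<in>S. f (q (h s) ^ e s))"
  proof (rule multiplicative_prod[OF f_mult assms(1)])
    fix s t assume st: "s \<in> S" "t \<in> S" "s \<noteq> t"
    then have "h s \<noteq> h t" using assms(2) by (auto dest: inj_onD)
    then have "q (h s) \<noteq> q (h t)"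
      using q_less[of "h s" "h t"] q_less[of "h t" "h s"] assms(3) st by (metis less_irrefl nat_neq_iff)
    then show "coprime (q (h s) ^ e s) (q (h t) ^ e t)"
      using prime_q assms(3) st by (intro coprime_power_left_iff[THEN iffD2] disjI1
        coprime_power_right_iff[THEN iffD2] primes_coprime) auto
  qed (use prime_q assms(3) prime_gt_0_nat in auto)
  also have "\<dots> = (\<Prod>s\<in>S. a * e s + 1)"
    using assms(3) f_prime_power by (intro prod.cong) auto
  finally show ?thesis .
qed

text \<open>Read by columns, the exponent of \<open>q j\<close> is the number of rows of length at
  least \<open>j\<close>. As row lengths decrease, these rows form an initial segment, so the
  logarithm of \<open>a * card (S j) + 1\<close> is the sum of their \<open>step_log\<close> values;
  interchanging the sums returns to rows.\<close>

lemma f_staircase: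
  fixes J :: "nat \<Rightarrow> nat" and n :: nat
  assumes J: "antimono J"
  defines "m \<equiv> \<Prod>(i, j)\<in>(SIGMA i:{..<n}. {1..J i}). q j"
  shows "f m > 0" and "ln (real (f m)) = (\<Sum>i<n. step_log a i * real (J i))"
proof -
  define S where "S j = {i \<in> {..<n}. j \<le> J i}" for j
  have S: "S j = {..<card (S j)}" for j
    by (rule finite_downward_closed_nat) (use J in \<open>auto simp: S_def antimono_def intro: order_trans\<close>)
  have Ji: "J i \<le> J 0" for i using J by (auto simp: antimono_def)
  have swap: "{j \<in> {1..J 0}. j \<le> J i} = {1..J i}" for i
    using Ji[of i] by auto
  have "m = (\<Prod>i<n. \<Prod>j\<in>{1..J i}. q j)"
    unfolding m_def by (subst prod.Sigma) auto
  also have "\<dots> = (\<Prod>i<n. \<Prod>j | j \<in> {1..J 0} \<and> j \<le> J i. q j)"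
    using swap by simp
  also have "\<dots> = (\<Prod>j\<in>{1..J 0}. \<Prod>i | i \<in> {..<n} \<and> j \<le> J i. q j)"
    by (rule prod.swap_restrict) auto
  also have "\<dots> = (\<Prod>j\<in>{1..J 0}. q j ^ card (S j))"
    by (simp add: S_def)
  finally have fm: "f m = (\<Prod>j\<in>{1..J 0}. a * card (S j) + 1)"
    using f_prod_prime_powers[of "{1..J 0}" "\<lambda>j. j"] by simp
  show "f m > 0" unfolding fm by (auto intro!: prod_pos)
  have "ln (real (f m)) = (\<Sum>j\<in>{1..J 0}. ln (real (a * card (S j) + 1)))"
    unfolding fm of_nat_prod by (rule ln_prod) (auto simp del: of_nat_add of_nat_Suc of_nat_mult)
  also have "\<dots> = (\<Sum>j\<in>{1..J 0}. \<Sum>i\<in>S j. step_log a i)"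
    by (intro sum.cong refl) (metis S sum_step_log)
  also have "\<dots> = (\<Sum>i<n. \<Sum>j | j \<in> {1..J 0} \<and> j \<le> J i. step_log a i)"
    unfolding S_def by (rule sum.swap_restrict) auto
  also have "\<dots> = (\<Sum>i<n. step_log a i * real (J i))"
    using swap by (simp add: mult.commute)
  finally show "ln (real (f m)) = (\<Sum>i<n. step_log a i * real (J i))" .
qed

text \<open>Each cell \<open>(i, j)\<close> of the staircase asks for a factor \<open>q j\<close> of
  \<open>f N\<close> and receives its own base prime with exponent \<open>(q j - 1) / a\<close>.
  \<open>Y\<close> controls the exponents and \<open>Z\<close> the logarithms of the base primes;
  summing \<open>j\<close> along row \<open>i\<close> gives
  \<open>J i * (J i + 1) / 2\<close>.\<close>

lemma exists_large_ff:
  assumes J: "antimono J" and \<kappa>: "\<kappa> \<ge> 0" and Y: "Y \<ge> 0"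
    and q_le: "\<And>j. 1 \<le> j \<Longrightarrow> j \<le> J 0 \<Longrightarrow> real (q j) \<le> \<kappa> * real j * Y"
    and ln_q_le: "\<And>j. 1 \<le> j \<Longrightarrow> j \<le> n * J 0 \<Longrightarrow> ln (real (q j)) \<le> Z"
  obtains N where "N \<ge> 1" "f (f N) > 0"
    "ln (real (f (f N))) = (\<Sum>i<n. step_log a i * real (J i))"
    "ln (real N) \<le> \<kappa> * Y * Z / (2 * real a) * (\<Sum>i<n. real (J i) * (real (J i) + 1))"
proof -
  define P where "P = (SIGMA i:{..<n}. {1..J i})"
  have P: "finite P" unfolding P_def by auto
  have Ji: "J i \<le> J 0" for i using J by (auto simp: antimono_def)
  have "card P = (\<Sum>i<n. J i)" by (simp add: P_def)
  also have "\<dots> \<le> n * J 0" using sum_bounded_above[of "{..<n}" J "J 0"] Ji by simp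
  finally have cardP: "card P \<le> n * J 0" .
  \<comment> \<open>Any enumeration of the cells will do, since every base prime is charged the same
    cost \<open>Z\<close>.\<close>
  obtain h where h: "bij_betw h P {1..card P}"
    by (metis P finite_same_card_bij finite_atLeastAtMost card_atLeastAtMost diff_Suc_1)
  have h1: "1 \<le> h s" "h s \<le> n * J 0" if "s \<in> P" for s
    using bij_betwE[OF h] that cardP by (auto intro: order_trans)
  define r where "r j = (SOME r. q j = a * r + 1)" for j
  have r: "q j = a * r j + 1" if "j \<ge> 1" for j
    unfolding r_def using someI_ex[OF q_cong[OF that]] .
  have Pj: "1 \<le> snd s" "snd s \<le> J 0" if "s \<in> P" for s
    using that Ji by (auto simp: P_def intro: order_trans)
  define N where "N = (\<Prod>s\<in>P. q (h s) ^ r (snd s))"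
  have q0: "q (h s) > 0" if "s \<in> P" for s using prime_q h1(1) that prime_gt_0_nat by auto
  have "f N = (\<Prod>s\<in>P. a * r (snd s) + 1)"
    unfolding N_def by (rule f_prod_prime_powers[OF P]) (use h1 bij_betw_imp_inj_on[OF h] in auto)
  also have "\<dots> = (\<Prod>s\<in>P. q (snd s))" using r Pj by (intro prod.cong) auto
  finally have fN: "f N = (\<Prod>(i, j)\<in>(SIGMA i:{..<n}. {1..J i}). q j)"
    by (simp add: P_def case_prod_unfold)
  have "ln (real N) = (\<Sum>s\<in>P. ln (real (q (h s)) ^ r (snd s)))"
    unfolding N_def of_nat_prod of_nat_power using q0 P by (intro ln_prod) auto
  also have "\<dots> = (\<Sum>s\<in>P. real (r (snd s)) * ln (real (q (h s))))"
    using q0 by (intro sum.cong) (auto simp: ln_realpow)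
  also have "\<dots> \<le> (\<Sum>s\<in>P. (\<kappa> * Y / real a * real (snd s)) * Z)"
  proof (intro sum_mono mult_mono)
    fix s assume s: "s \<in> P"
    show "ln (real (q (h s))) \<le> Z" using ln_q_le h1[OF s] by auto
    have "real a * real (r (snd s)) \<le> real (q (snd s))"
      using r[OF Pj(1)[OF s]] by simp
    also have "\<dots> \<le> \<kappa> * real (snd s) * Y" using q_le Pj[OF s] by auto
    finally show "real (r (snd s)) \<le> \<kappa> * Y / real a * real (snd s)"
      using a_pos by (simp add: field_simps)
    show "0 \<le> ln (real (q (h s)))" using q0[OF s] by simp
  qed (use \<kappa> Y in auto)
  also have "\<dots> = \<kappa> * Y * Z / real a * (\<Sum>s\<in>P. real (snd s))"
    by (simp add: sum_distrib_left sum_divide_distrib mult_ac)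
  also have "(\<Sum>s\<in>P. real (snd s)) = (\<Sum>i<n. \<Sum>j\<in>{1..J i}. real j)"
    unfolding P_def by (subst sum.Sigma) (auto simp: case_prod_unfold)
  also have "\<dots> = (\<Sum>i<n. real (J i) * (real (J i) + 1) / 2)"
    using double_gauss_sum_from_Suc_0[where 'a = real] by (intro sum.cong refl) (simp add: field_simps)
  also have "\<dots> = (\<Sum>i<n. real (J i) * (real (J i) + 1)) / 2"
    by (simp add: sum_divide_distrib)
  finally have "ln (real N) \<le> \<kappa> * Y * Z / (2 * real a) * (\<Sum>i<n. real (J i) * (real (J i) + 1))"
    by simp
  moreover have "N > 0" unfolding N_def using q0 by (intro prod_pos) auto
  ultimately show ?thesis using f_staircase[OF J, of n] fN that[of N] by simp
qed

text \<open>Makes the factor after \<open>\<kappa> * j\<close> uniform over all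
  \<open>j \<le> y\<close>. The condition \<open>y \<ge> 3\<close> ensures
  \<open>ln (ln y) \<ge> 0\<close>.\<close>

lemma q_upper_bound:
  assumes \<kappa>: "\<kappa> > 0" and e: "e \<in> O(\<lambda>_. 1 :: real)"
    and q_eq: "\<And>j. j \<ge> 2 \<Longrightarrow> real (q j) = \<kappa> * real j * (ln (real j) + ln (ln (real j)) + e j)"
  obtains C where "\<And>j y. 1 \<le> j \<Longrightarrow> real j \<le> y \<Longrightarrow> y \<ge> 3 \<Longrightarrow>
      real (q j) \<le> \<kappa> * real j * (ln y + ln (ln y) + C)"
proof -
  from e obtain c where "eventually (\<lambda>j. norm (e j) \<le> c * norm (1::real)) sequentially"
    by (elim landau_o.bigE)
  then have "Bseq e" by (auto intro: BfunI)
  then obtain B where B: "\<And>j. \<bar>e j\<bar> \<le> B" unfolding real_norm_def[symmetric] by (elim BseqE) blast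
  \<comment> \<open>The last two entries cover the indices 1 and 2 directly, without the asymptotic
    formula.\<close>
  define C where "C = Max {B, real (q 1) / \<kappa>, real (q 2) / (2 * \<kappa>)}"
  have C: "B \<le> C" "real (q 1) / \<kappa> \<le> C" "real (q 2) / (2 * \<kappa>) \<le> C"
    by (auto simp: C_def)
  have "real (q j) \<le> \<kappa> * real j * (ln y + ln (ln y) + C)"
    if j: "1 \<le> j" "real j \<le> y" "y \<ge> 3" for j y
  proof -
    have ln3: "ln (3::real) \<ge> 1" using ln3_gt_1 by simp
    have lny: "ln y \<ge> 1" using ln3 ln_mono[of 3 y] j by linarith
    have "real (q j) / (\<kappa> * real j) \<le> ln y + ln (ln y) + C"
    proof (cases "j \<ge> 3")
      case True
      have "ln (real j) \<ge> 1" using ln3 ln_mono[of 3 "real j"] True by linarith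
      then have "ln (ln (real j)) \<le> ln (ln y)" using j True by (intro ln_mono) auto
      moreover have "ln (real j) \<le> ln y" using j by (intro ln_mono) auto
      moreover have "real (q j) / (\<kappa> * real j) = ln (real j) + ln (ln (real j)) + e j"
        using q_eq[of j] True \<kappa> by simp
      ultimately show ?thesis using B[of j] C by linarith
    next
      case False
      then have "j = 1 \<or> j = 2" using j by auto
      then have "real (q j) / (\<kappa> * real j) \<le> C" using C by (auto simp: mult.commute)
      moreover have "ln (ln y) \<ge> 0" using lny by simp
      ultimately show ?thesis using lny by linarith
    qed
    then show ?thesis using \<kappa> j by (simp add: field_simps)
  qed
  then show ?thesis using that by blast
qed

text \<open>Uses row lengths proportional to \<open>step_log a i\<close>, the optimal profile. The
  loss in the value comes from truncating the series at \<open>n\<close> and from rounding, which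
  costs less than 2 units of length per row.\<close>

lemma exists_large_ff_scaled:
  fixes \<kappa> l Y Z :: real and n :: nat
  assumes \<kappa>: "\<kappa> > 0" and l: "l \<ge> 0" and n: "n \<ge> 2" and Y: "Y \<ge> 0" and Z: "Z \<ge> 0"
    and q_le: "\<And>j. 1 \<le> j \<Longrightarrow> real j \<le> l * step_log a 0 \<Longrightarrow> real (q j) \<le> \<kappa> * real j * Y"
    and ln_q_le: "\<And>j. 1 \<le> j \<Longrightarrow> real j \<le> real n * (l * step_log a 0) \<Longrightarrow> ln (real (q j)) \<le> Z"
  defines "D \<equiv> (\<Sum>i. (step_log a i)\<^sup>2)"
  obtains N where "N \<ge> 1" "f (f N) > 0"
    "ln (real (f (f N))) \<ge> l * (D - 1 / (real n - 1)) - 2 * real n * step_log a 0"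
    "ln (real N) \<le> \<kappa> * Y * Z / (2 * real a) * (l\<^sup>2 * D)"
proof -
  \<comment> \<open>The shift by 1 makes \<open>J i * (J i + 1) \<le> (l * step_log a i)\<^sup>2\<close>, so that the cost has no lower-order terms.\<close>
  define J where "J i = nat \<lfloor>l * step_log a i - 1\<rfloor>" for i
  have J: "antimono J"
    unfolding J_def antimono_def using l
    by (auto intro!: nat_mono floor_mono diff_right_mono mult_left_mono step_log_antimono)
  have J_le: "real (J i) \<le> l * step_log a i" for i
    using l step_log_nonneg[of a i] unfolding J_def
    by (cases "l * step_log a i - 1 \<ge> 0") (auto, linarith)
  \<comment> \<open>One unit is lost to the shift and at most one to the floor; cutting negative
    values to 0 by \<open>nat\<close> only helps.\<close>
  have J_ge: "real (J i) \<ge> l * step_log a i - 2" for i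
    unfolding J_def by linarith
  have J_prod: "real (J i) * (real (J i) + 1) \<le> l\<^sup>2 * (step_log a i)\<^sup>2" for i
  proof (cases "J i = 0")
    case False
    then have "real (J i) + 1 \<le> l * step_log a i" unfolding J_def by linarith
    then have "real (J i) * (real (J i) + 1) \<le> (l * step_log a i) * (l * step_log a i)"
      by (intro mult_mono) auto
    then show ?thesis by (simp add: power2_eq_square mult_ac)
  qed simp
  obtain N where N: "N \<ge> 1" "f (f N) > 0"
    "ln (real (f (f N))) = (\<Sum>i<n. step_log a i * real (J i))"
    "ln (real N) \<le> \<kappa> * Y * Z / (2 * real a) * (\<Sum>i<n. real (J i) * (real (J i) + 1))"
  proof (rule exists_large_ff[OF J less_imp_le[OF \<kappa>] Y])
    show "real (q j) \<le> \<kappa> * real j * Y" if "1 \<le> j" "j \<le> J 0" for j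
      using that J_le[of 0] by (intro q_le) auto
    show "ln (real (q j)) \<le> Z" if "1 \<le> j" "j \<le> n * J 0" for j
    proof (rule ln_q_le[OF that(1)])
      have "real j \<le> real n * real (J 0)" using that(2) by (metis of_nat_le_iff of_nat_mult)
      also have "\<dots> \<le> real n * (l * step_log a 0)" using J_le by (intro mult_left_mono) auto
      finally show "real j \<le> real n * (l * step_log a 0)" .
    qed
  qed
  have "(\<Sum>i<n. real (J i) * (real (J i) + 1)) \<le> (\<Sum>i<n. l\<^sup>2 * (step_log a i)\<^sup>2)"
    by (intro sum_mono J_prod)
  also have "\<dots> = l\<^sup>2 * (\<Sum>i<n. (step_log a i)\<^sup>2)" by (simp add: sum_distrib_left)
  also have "\<dots> \<le> l\<^sup>2 * D" unfolding D_def
    by (intro mult_left_mono sum_le_suminf summable_step_log_square) auto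
  finally have "ln (real N) \<le> \<kappa> * Y * Z / (2 * real a) * (l\<^sup>2 * D)"
    using N(4) \<kappa> Y Z by (meson mult_left_mono order_trans divide_nonneg_nonneg mult_nonneg_nonneg
        of_nat_0_le_iff less_imp_le zero_le_numeral)
  moreover have "l * (D - 1 / (real n - 1)) - 2 * real n * step_log a 0 \<le> ln (real (f (f N)))"
  proof -
    have "l * (D - 1 / (real n - 1)) \<le> l * (\<Sum>i<n. (step_log a i)\<^sup>2)"
      using step_log_square_tail[OF n, of a] l unfolding D_def by (intro mult_left_mono) auto
    moreover have "(\<Sum>i<n. step_log a i) \<le> real n * step_log a 0"
      using sum_bounded_above[of "{..<n}" "step_log a" "step_log a 0"] step_log_antimono by simp
    moreover have "l * (\<Sum>i<n. (step_log a i)\<^sup>2) - 2 * (\<Sum>i<n. step_log a i)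
        = (\<Sum>i<n. step_log a i * (l * step_log a i - 2))"
      by (simp add: sum_distrib_left sum_subtractf algebra_simps power2_eq_square)
    moreover have "\<dots> \<le> (\<Sum>i<n. step_log a i * real (J i))"
      by (intro sum_mono mult_left_mono J_ge step_log_nonneg)
    ultimately show ?thesis using N(3) by linarith
  qed
  ultimately show ?thesis using N that by blast
qed

end

section \<open>Passage to the maximum and asymptotic choice of the parameters\<close>

lemma max_log_ff_ge:
  assumes "n \<ge> 1" "real n \<le> x" "f (f n) > 0"
  shows "ereal (ln (real (f (f n)))) \<le> max_log_ff f x"
proof -
  have "{n. n \<ge> 1 \<and> real n \<le> x} \<subseteq> {..nat \<lfloor>x\<rfloor>}"
    by (auto simp: le_nat_floor)
  then have "finite {n. n \<ge> 1 \<and> real n \<le> x}" by (rule finite_subset) simp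
  then have "elog (f (f n)) \<le> max_log_ff f x"
    unfolding max_log_ff_def using assms by (intro Max_ge) auto
  then show ?thesis using assms by (simp add: elog_def)
qed

text \<open>Write \<open>L\<close>, \<open>T\<close>, \<open>U\<close> for the first three iterated
  logarithms of \<open>x\<close>. With \<open>l\<close> about \<open>A * sqrt L / T\<close> and
  \<open>n\<close> about \<open>T\<close>, truncation costs order \<open>sqrt L / T^2\<close> and
  rounding order \<open>T\<close>, both within the allowed error
  \<open>sqrt L * U / T^2\<close>.\<close>

lemma (in linear_exponents) max_log_ff_lower_bound:
  fixes \<kappa> :: real
  assumes \<kappa>: "\<kappa> > 0" and e: "e \<in> O(\<lambda>_. 1 :: real)"
    and q_eq: "\<And>j. j \<ge> 2 \<Longrightarrow> real (q j) = \<kappa> * real j * (ln (real j) + ln (ln (real j)) + e j)"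
  defines "D \<equiv> (\<Sum>i. (step_log a i)\<^sup>2)"
  shows "\<exists>c. \<forall>\<^sub>F x in at_top. ereal (sqrt (ln x) / ln (ln x) *
           (sqrt (8 * D) / sqrt (\<kappa> / real a) - c * (ln (ln (ln x)) / ln (ln x)))) \<le> max_log_ff f x"
proof -
  obtain C where C: "\<And>j y. 1 \<le> j \<Longrightarrow> real j \<le> y \<Longrightarrow> y \<ge> 3 \<Longrightarrow>
      real (q j) \<le> \<kappa> * real j * (ln y + ln (ln y) + C)"
    using q_upper_bound[OF \<kappa> e q_eq] by blast
  define d where "d = step_log a 0"
  have d: "d > 0" unfolding d_def using a_pos by (rule step_log_pos)
  have D: "D > 0" unfolding D_def
    by (rule suminf_pos2[of _ 0]) (use summable_step_log_square step_log_pos[OF a_pos, of 0] in auto)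
  \<comment> \<open>Solves \<open>\<kappa> / (2 * a) * (T / 2)^2 * l^2 * D = L\<close> for
    \<open>l = A * sqrt L / T\<close>: to leading order the cost uses up all of
    \<open>ln x\<close>.\<close>
  define A where "A = sqrt (8 * real a / (\<kappa> * D))"
  have A: "A > 0" and A2: "A\<^sup>2 = 8 * real a / (\<kappa> * D)"
    using a_pos \<kappa> D by (auto simp: A_def)
  have AD: "A * D = sqrt (8 * D) / sqrt (\<kappa> / real a)"
  proof -
    have "A * D = sqrt (8 * real a / (\<kappa> * D)) * sqrt (D\<^sup>2)" using D by (simp add: A_def)
    also have "\<dots> = sqrt (8 * D / (\<kappa> / real a))"
      unfolding real_sqrt_mult[symmetric] using D by (simp add: power2_eq_square)
    finally show ?thesis by (simp only: real_sqrt_divide)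
  qed
  \<comment> \<open>The third and fourth items bound the indices of the prime factors of
    \<open>f N\<close> and of the base primes by \<open>sqrt L\<close> and
    \<open>sqrt L * T\<close>; items seven and nine then bound the sizes. In the last item,
    \<open>6 * (A * D)\<close> pays for shrinking \<open>l\<close> by \<open>1 - 6 * U / T\<close>,
    and the extra 1 absorbs truncation and rounding.\<close>
  have growth:
    "\<forall>\<^sub>F x in at_top. ln (ln (ln (x::real))) > 0"
    "\<forall>\<^sub>F x in at_top. ln (ln x) > (6::real) * ln (ln (ln x))"
    "\<forall>\<^sub>F x in at_top. A * (sqrt (ln x) / ln (ln x)) * d \<le> sqrt (ln x)"
    "\<forall>\<^sub>F x in at_top. (ln (ln x) + 1) * (A * (sqrt (ln x) / ln (ln x)) * d) \<le> sqrt (ln x) * ln (ln x)"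
    "\<forall>\<^sub>F x in at_top. sqrt (ln x) \<ge> 3"
    "\<forall>\<^sub>F x in at_top. sqrt (ln x) * ln (ln x) \<ge> 3"
    "\<forall>\<^sub>F x in at_top. ln (sqrt (ln x)) + ln (ln (sqrt (ln x))) + C \<le> ln (ln x) / 2 + 3 * ln (ln (ln x))"
    "\<forall>\<^sub>F x in at_top. 0 < ln (sqrt (ln x) * ln (ln x)) + ln (ln (sqrt (ln x) * ln (ln x))) + C"
    "\<forall>\<^sub>F x in at_top. ln (\<kappa> * (sqrt (ln x) * ln (ln x)) *
        (ln (sqrt (ln x) * ln (ln x)) + ln (ln (sqrt (ln x) * ln (ln x))) + C))
        \<le> ln (ln x) / 2 + 3 * ln (ln (ln x))"
    "\<forall>\<^sub>F x in at_top. sqrt (ln x) / ln (ln x) * (A * D - (6 * (A * D) + 1) * (ln (ln (ln x)) / ln (ln x))) \<le>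
        A * (sqrt (ln x) / ln (ln x)) * (1 - 6 * (ln (ln (ln x)) / ln (ln x))) *
          (D - 1 / (ln (ln x) - 1)) - 2 * (ln (ln x) + 1) * d"
    using \<kappa> A d by - real_asymp+
  have "\<forall>\<^sub>F x in at_top. ereal (sqrt (ln x) / ln (ln x) *
           (A * D - (6 * (A * D) + 1) * (ln (ln (ln x)) / ln (ln x)))) \<le> max_log_ff f x"
    using growth eventually_gt_at_top[of 1]
  proof eventually_elim
    case (elim x)
    define L T U where "L = ln x" and "T = ln (ln x)" and "U = ln (ln (ln x))"
    note facts = elim(1-10)[folded T_def U_def, folded T_def, folded L_def]
    have U: "U > 0" "T > 6 * U" using facts(1,2) by auto
    have T1: "T > 1" using U unfolding T_def U_def by (smt (verit) ln_le_zero_iff)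
    have L: "L > 0" using elim unfolding L_def by auto
    \<comment> \<open>The factor \<open>1 - 6 U / T\<close> absorbs \<open>(2 * W / T) = 1 + 6 U / T\<close>, the error in the sizes of the primes.\<close>
    define l where "l = A * (sqrt L / T) * (1 - 6 * (U / T))"
    define n where "n = nat \<lceil>T\<rceil>"
    \<comment> \<open>One bound serves as both \<open>Y\<close> and \<open>Z\<close>. For a base
      prime, the index bound \<open>sqrt L * T\<close> contributes \<open>T / 2 + U\<close> to the
      logarithm and the factor of order \<open>T\<close> beyond the index about another
      \<open>U\<close>; the third \<open>U\<close> absorbs constants.\<close>
    define W where "W = T / 2 + 3 * U"
    have n: "n \<ge> 2" "T \<le> real n" "real n \<le> T + 1" using T1 unfolding n_def by linarith+
    have frac: "0 \<le> 1 - 6 * (U / T)" "1 - 6 * (U / T) \<le> 1" using U by (auto simp: field_simps)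
    have l: "l \<ge> 0" unfolding l_def using A L T1 frac by auto
    have l_le: "l \<le> A * (sqrt L / T)" unfolding l_def
      using A L T1 frac by (intro mult_right_le_one_le) auto
    have W: "W \<ge> 0" using U unfolding W_def by auto
    have ld: "l * d \<le> A * (sqrt L / T) * d" using l_le d by (intro mult_right_mono) auto
    obtain N where N: "N \<ge> 1" "f (f N) > 0"
      "ln (real (f (f N))) \<ge> l * (D - 1 / (real n - 1)) - 2 * real n * d"
      "ln (real N) \<le> \<kappa> * W * W / (2 * real a) * (l\<^sup>2 * D)"
      unfolding d_def D_def
    proof (rule exists_large_ff_scaled[OF \<kappa> l n(1) W W])
      show "real (q j) \<le> \<kappa> * real j * W" if j: "1 \<le> j" "real j \<le> l * step_log a 0" for j
      proof -
        have "real j \<le> sqrt L" using j ld facts(3) unfolding d_def by linarith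
        then have "real (q j) \<le> \<kappa> * real j * (ln (sqrt L) + ln (ln (sqrt L)) + C)"
          using C j facts(5) by blast
        also have "\<dots> \<le> \<kappa> * real j * W"
          using facts(7) \<kappa> unfolding W_def by (intro mult_left_mono) auto
        finally show ?thesis .
      qed
      show "ln (real (q j)) \<le> W" if j: "1 \<le> j" "real j \<le> real n * (l * step_log a 0)" for j
      proof -
        have "real n * (l * d) \<le> (T + 1) * (A * (sqrt L / T) * d)"
          using n ld l d T1 by (intro mult_mono) (auto simp del: times_divide_eq_right)
        then have jy: "real j \<le> sqrt L * T" using j facts(4) unfolding d_def by linarith
        have "real (q j) \<le> \<kappa> * real j * (ln (sqrt L * T) + ln (ln (sqrt L * T)) + C)"
          using C[OF j(1) jy facts(6)] .
        also have "\<dots> \<le> \<kappa> * (sqrt L * T) * (ln (sqrt L * T) + ln (ln (sqrt L * T)) + C)"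
          using jy facts(8) \<kappa> by (intro mult_right_mono mult_left_mono) auto
        finally have "ln (real (q j)) \<le> ln (\<kappa> * (sqrt L * T) * (ln (sqrt L * T) + ln (ln (sqrt L * T)) + C))"
          using prime_q[OF j(1)] prime_gt_0_nat by (intro ln_mono) auto
        then show ?thesis using facts(9) unfolding W_def by linarith
      qed
    qed
    have "\<kappa> * W * W / (2 * real a) * (l\<^sup>2 * D) = L * ((2 * W / T) * (1 - 6 * (U / T)))\<^sup>2"
      unfolding l_def power_mult_distrib A2 power_divide using a_pos \<kappa> D T1 L
      by (simp add: field_simps power2_eq_square)
    also have "(2 * W / T) * (1 - 6 * (U / T)) = 1 - (6 * (U / T))\<^sup>2"
      unfolding W_def using T1 by (simp add: field_simps power2_eq_square)
    also have "(1 - (6 * (U / T))\<^sup>2)\<^sup>2 \<le> 1"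
      using frac U T1 by (intro power_le_one) (auto simp: abs_square_le_1 power_le_one)
    then have "L * (1 - (6 * (U / T))\<^sup>2)\<^sup>2 \<le> L" using L by (simp add: mult_le_cancel_left2)
    finally have "ln (real N) \<le> ln x" using N(4) unfolding L_def by linarith
    then have "real N \<le> x" using N(1) elim by (subst (asm) ln_le_cancel_iff) auto
    then have "ereal (ln (real (f (f N)))) \<le> max_log_ff f x"
      using N by (intro max_log_ff_ge)
    moreover have "sqrt L / T * (A * D - (6 * (A * D) + 1) * (U / T)) \<le> ln (real (f (f N)))"
    proof -
      have "l * (D - 1 / (T - 1)) \<le> l * (D - 1 / (real n - 1))"
        using n T1 l by (intro mult_left_mono diff_left_mono divide_left_mono) auto
      moreover have "2 * real n * d \<le> 2 * (T + 1) * d" using n d by (intro mult_right_mono) auto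
      ultimately show ?thesis using N(3) facts(10) unfolding l_def by linarith
    qed
    ultimately show ?case unfolding L_def T_def U_def by (meson ereal_less_eq(3) order_trans)
  qed
  then show ?thesis unfolding AD by blast
qed

section \<open>Reduction of the stated hypotheses to the linear setting\<close>

theorem theorem4p2:
  fixes q :: "nat \<Rightarrow> nat" and Q :: "nat set" and g f :: "nat \<Rightarrow> nat"
    and \<kappa> \<alpha> c_star c_f c_dagger \<epsilon> :: real
  assumes q_primes: "\<And>j. j \<ge> 1 \<Longrightarrow> prime (q j)"
    and q_strict: "strict_mono_on {1..} q"
    and Q_eq: "Q = q ` {1..}"
    and g_pos: "\<And>\<nu>. g \<nu> \<ge> 1"
    and g_0: "g 0 = 1"
    and \<kappa>_pos: "\<kappa> > 0"
    and A1: "\<exists>e :: nat \<Rightarrow> real. e \<in> O(\<lambda>_. 1) \<and>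
          (\<forall>j\<ge>2. real (q j) = \<kappa> * real j * (ln (real j) + ln (ln (real j)) + e j))"
    and A2: "mono g"
    and A3: "mult_monoid Q \<subseteq> range g"
    and c_star: "c_star > 1 / real (q 1)"
    and A4: "\<And>a b. a \<in> mult_monoid Q \<Longrightarrow> b \<in> mult_monoid Q \<Longrightarrow> q 1 \<le> a \<Longrightarrow> a \<le> b \<Longrightarrow>
          ereal_of_enat (gdagger g b) + ereal (c_star * real b) * ereal_of_enat (gdagger g a)
            \<le> ereal_of_enat (gdagger g (a * b))"
    and \<epsilon>_pos: "\<epsilon> > 0"
    and A5: "(\<lambda>i. real (g i) / real (g (i - 1)) - 1) \<in> O(\<lambda>i. real i powr (- 1 / 2 - \<epsilon>))"
    and c_f_pos: "c_f > 0"
    and A6: "\<And>x. x \<ge> 1 \<Longrightarrow> real (g x) \<le> c_f * real x"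
    and c_dagger_pos: "c_dagger > 0"
    and A7: "\<exists>K N. \<forall>p\<in>Q. p \<ge> N \<longrightarrow>
          \<bar>ereal_of_enat (gdagger g p) - ereal (c_dagger * real p)\<bar>
            \<le> ereal (K * (real p / ln (real p)))"
    and f_mult: "multiplicative f"
    and f_Q: "\<And>p \<nu>. prime p \<Longrightarrow> \<nu> \<ge> 1 \<Longrightarrow> p \<in> Q \<Longrightarrow> f (p ^ \<nu>) = g \<nu>"
    and f_not_Q: "\<And>p \<nu>. prime p \<Longrightarrow> \<nu> \<ge> 1 \<Longrightarrow> p \<notin> Q \<Longrightarrow> f (p ^ \<nu>) \<in> {0, 1}"
    and f_0: "f 0 = 1"
    and g_linear: "\<And>\<nu>. real (g \<nu>) = \<alpha> * real \<nu> + 1"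
  shows "\<exists>E :: real \<Rightarrow> real. E \<in> O(\<lambda>x. ln (ln (ln x)) / ln (ln x)) \<and>
          (\<forall>\<^sub>F x in at_top. max_log_ff f x \<ge>
             ereal (sqrt (ln x) / ln (ln x) * (C_const g / sqrt (\<kappa> / \<alpha>) + E x)))"
proof -
  \<comment> \<open>Since \<open>g 1 = \<alpha> + 1\<close> is a positive integer, \<alpha> is a
    natural number.\<close>
  define a where "a = g 1 - 1"
  have \<alpha>: "\<alpha> = real a" using g_linear[of 1] g_pos[of 1] by (simp add: a_def)
  have g: "g \<nu> = a * \<nu> + 1" for \<nu>
    using g_linear[of \<nu>] unfolding \<alpha> by (metis of_nat_1 of_nat_add of_nat_eq_iff of_nat_mult)
  have q_cong: "\<exists>r. q j = a * r + 1" if "j \<ge> 1" for j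
  proof -
    \<comment> \<open>A singleton multiset puts \<open>q j\<close> in the monoid, so (A.3) makes it
      a value of \<open>g\<close>.\<close>
    have "q j \<in> mult_monoid Q"
      using that unfolding mult_monoid_def Q_eq by (auto intro!: exI[of _ "{#q j#}"])
    then show ?thesis using A3 g by auto
  qed
  have "linear_exponents q f a"
  proof
    \<comment> \<open>If \<open>a\<close> were 0, the congruence would force \<open>q 1 = 1\<close>,
      which is not prime.\<close>
    show "a > 0" using q_cong[of 1] q_primes[of 1] by (cases "a = 0") auto
    show "f (q j ^ \<nu>) = a * \<nu> + 1" if "j \<ge> 1" for j \<nu>
    proof (cases "\<nu> = 0")
      case True
      then show ?thesis using f_mult by (simp add: multiplicative_def)
    next
      case False
      then show ?thesis using f_Q[of "q j" \<nu>] q_primes that Q_eq g by auto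
    qed
  qed (use q_primes q_strict f_mult q_cong in auto)
  then interpret linear_exponents q f a .
  obtain e where "e \<in> O(\<lambda>_. 1 :: real)"
    "\<And>j. j \<ge> 2 \<Longrightarrow> real (q j) = \<kappa> * real j * (ln (real j) + ln (ln (real j)) + e j)"
    using A1 by blast
  from max_log_ff_lower_bound[OF \<kappa>_pos this] obtain c where c:
    "\<forall>\<^sub>F x in at_top. ereal (sqrt (ln x) / ln (ln x) *
        (sqrt (8 * (\<Sum>i. (step_log a i)\<^sup>2)) / sqrt (\<kappa> / real a)
          - c * (ln (ln (ln x)) / ln (ln x)))) \<le> max_log_ff f x"
    by blast
  have "ln (real (g (Suc i)) / real (g i)) = step_log a i" for i
    unfolding g step_log_eq by (rule ln_divide_pos) (simp_all del: of_nat_add of_nat_Suc of_nat_mult)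
  then have "C_const g = sqrt (8 * (\<Sum>i. (step_log a i)\<^sup>2))"
    by (simp add: C_const_def)
  moreover have "(\<lambda>x. - c * (ln (ln (ln x)) / ln (ln x))) \<in> O(\<lambda>x. ln (ln (ln x)) / ln (ln x :: real))"
    by (rule bigoI[of _ "\<bar>c\<bar>"]) (simp add: abs_mult)
  ultimately show ?thesis using c
    by (intro exI[of _ "\<lambda>x. - c * (ln (ln (ln x)) / ln (ln x))"]) (simp add: \<alpha>)
qed

end
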